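(* Let $\mathscr{P}=\{p_\theta:\theta\in\Theta\}$ be a probability model of distributions on $\mathbb{R}^k$, let $\rho$ be a metric (or pseudometric) on $\Theta$, and let the loss function be $\ell(\theta,\hat\theta)=\Phi(\rho(\theta,\hat\theta))$, where $\Phi:\mathbb{R}^+\to\mathbb{R}^+$ is nondecreasing with $\Phi(0)=0$. Let $\delta>0$ and let $\{\theta_1,\ldots,\theta_m\}\subseteq\Theta$ satisfy $\rho(\theta_j,\theta_{j'})\ge2\delta$ for every $j\ne j'$. Let $J\sim\mathrm{Unif}\{1,\ldots,m\}$ and, conditioned on $J=j$, let $\mathbf{X}^n=(\mathbf{X}_1,\ldots,\mathbf{X}_n)$ be i.i.d. from $p_{\theta_j}$. Then the minimax risk of estimating $\theta$ from $n$ i.i.d. samples satisfies $$\mathscr{R}_n(\mathscr{P},\ell)\ge\Phi(\delta)\inf_{\psi}\mathsf{Pr}\{\psi(\mathbf{X}^n)\ne J\},$$ where the infimum is over all measurable test functions $\psi:\mathbb{R}^{kn}\to\{1,\ldots,m\}$.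
   Context: An estimator is a (measurable) function $\hat\theta:\mathbb{R}^{kn}\to\Theta$. Its risk is $R_n(\theta,\hat\theta)=\mathsf{E}(\ell(\theta,\hat\theta(\mathbf{X}^n)))$ with $\mathbf{X}_1,\ldots,\mathbf{X}_n$ i.i.d. from $p_\theta$, and the minimax risk is $\mathscr{R}_n(\mathscr{P},\ell)=\inf_{\hat\theta}\sup_{\theta\in\Theta}R_n(\theta,\hat\theta)$. $\mathbb{R}^+=[0,\infty)$. *)

theory Defs
  imports "HOL-Probability.Probability"
begin

definition pseudometric_on :: "'a set \<Rightarrow> ('a \<Rightarrow> 'a \<Rightarrow> real) \<Rightarrow> bool" where
  "pseudometric_on S \<rho> \<longleftrightarrow>
     (\<forall>x\<in>S. \<forall>y\<in>S. 0 \<le> \<rho> x y \<and> \<rho> x y = \<rho> y x) \<and>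
     (\<forall>x\<in>S. \<rho> x x = 0) \<and>
     (\<forall>x\<in>S. \<forall>y\<in>S. \<forall>z\<in>S. \<rho> x z \<le> \<rho> x y + \<rho> y z)"

text \<open>A sample $(x_1,\ldots,x_n)$ of points of $\mathbf{R}^k$ is a function on the index set
  $\{1,\ldots,n\}$, and $\mathbf{R}^{kn}$ is the corresponding product of Borel spaces.\<close>

abbreviation sample_space :: "nat \<Rightarrow> (nat \<Rightarrow> real ^ 'k) measure" where
  "sample_space n \<equiv> Pi\<^sub>M {1..n} (\<lambda>_. borel)"

definition iid_from ::
    "'w measure \<Rightarrow> nat \<Rightarrow> (real ^ 'k) measure \<Rightarrow> (nat \<Rightarrow> 'w \<Rightarrow> real ^ 'k) \<Rightarrow> bool" where
  "iid_from M n D X \<longleftrightarrow>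
     prob_space.indep_vars M (\<lambda>_. borel) X {1..n} \<and> (\<forall>i\<in>{1..n}. distr M borel (X i) = D)"

text \<open>The parameter set is the underlying space of a measure \<open>\<Theta>\<close>, of which only the
  sigma-algebra is used (to say which estimators are measurable).  Expectations of the
  nonnegative loss may be infinite, so risks are extended nonnegative reals; the law of
  $n$ independent samples from \<open>p \<theta>\<close> is the product measure.\<close>

definition risk ::
    "('a \<Rightarrow> (real ^ 'k) measure) \<Rightarrow> ('a \<Rightarrow> 'a \<Rightarrow> real) \<Rightarrow> nat \<Rightarrow>
     'a \<Rightarrow> ((nat \<Rightarrow> real ^ 'k) \<Rightarrow> 'a) \<Rightarrow> ennreal" where
  "risk p \<l> n \<theta> est = (\<integral>\<^sup>+ x. ennreal (\<l> \<theta> (est x)) \<partial>(Pi\<^sub>M {1..n} (\<lambda>_. p \<theta>)))"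

definition minimax_risk ::
    "'a measure \<Rightarrow> ('a \<Rightarrow> (real ^ 'k) measure) \<Rightarrow> ('a \<Rightarrow> 'a \<Rightarrow> real) \<Rightarrow> nat \<Rightarrow> ennreal" where
  "minimax_risk \<Theta> p \<l> n =
     (INF est\<in>sample_space n \<rightarrow>\<^sub>M \<Theta>. SUP \<theta>\<in>space \<Theta>. risk p \<l> n \<theta> est)"

end

theory Submission
  imports Defs
begin

text \<open>Test by the hypothesis whose loss against the estimate is below \<open>\<Phi> \<delta>\<close>.  Such a
  hypothesis lies within \<open>\<delta>\<close> of the estimate, so by separation there is at most one;
  hence an error under hypothesis \<open>j\<close> costs the estimator at least \<open>\<Phi> \<delta>\<close>, and the supremum
  of the risks dominates their average over \<open>j\<close>.  Thresholding the loss rather than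
  \<open>\<rho>\<close> itself keeps the test measurable without assuming measurability of \<open>\<rho>\<close>.\<close>

text \<open>Links the two descriptions of sampling: independent variables on the underlying space on
  the one hand, the product measure integrated in \<open>risk\<close> on the other. It will be
  applied with \<open>U\<close> the conditional law given \<open>J = j\<close>.\<close>

lemma distr_iid_from:
  fixes X :: "nat \<Rightarrow> 'w \<Rightarrow> real ^ 'k"
  assumes "prob_space U" and iid: "iid_from U n D X"
  shows "(\<lambda>\<omega>. \<lambda>i\<in>{1..n}. X i \<omega>) \<in> U \<rightarrow>\<^sub>M sample_space n"
    and "distr U (sample_space n) (\<lambda>\<omega>. \<lambda>i\<in>{1..n}. X i \<omega>) = Pi\<^sub>M {1..n} (\<lambda>_. D)"
proof -
  interpret prob_space U by fact
  have ind: "indep_vars (\<lambda>_. borel) X {1..n}"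
    and law: "\<And>i. i \<in> {1..n} \<Longrightarrow> distr U borel (X i) = D"
    using iid by (auto simp: iid_from_def)
  have X: "\<And>i. i \<in> {1..n} \<Longrightarrow> random_variable borel (X i)"
    using ind by (auto simp: indep_vars_def)
  show "(\<lambda>\<omega>. \<lambda>i\<in>{1..n}. X i \<omega>) \<in> U \<rightarrow>\<^sub>M sample_space n"
    using X by (intro measurable_restrict) auto
  show "distr U (sample_space n) (\<lambda>\<omega>. \<lambda>i\<in>{1..n}. X i \<omega>) = Pi\<^sub>M {1..n} (\<lambda>_. D)"
  proof (cases "n = 0")
    \<comment> \<open>The characterization of independence by the joint law, used in the other case,
      needs a nonempty index set. Here the sample space has the single point
      \<open>\<lambda>_. undefined\<close>, so two measures agree once both give it mass 1.\<close>
    case True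
    have "emeasure (distr U (sample_space 0) (\<lambda>\<omega>. \<lambda>i\<in>{}. X i \<omega>)) {\<lambda>_. undefined} = 1"
      by (subst emeasure_distr) (auto simp: space_PiM sets_PiM_empty emeasure_space_1 restrict_def intro!: measurable_restrict)
    then show ?thesis
      using True by (intro measure_eqI) (auto simp: PiM_empty dest!: subset_singletonD)
  next
    case False
    have "distr U (sample_space n) (\<lambda>\<omega>. \<lambda>i\<in>{1..n}. X i \<omega>)
        = Pi\<^sub>M {1..n} (\<lambda>i. distr U borel (X i))"
      using ind False X by (subst (asm) indep_vars_iff_distr_eq_PiM') auto
    also have "\<dots> = Pi\<^sub>M {1..n} (\<lambda>_. D)"
      using law by (intro PiM_cong) auto
    finally show ?thesis .
  qed
qed

lemma emeasure_uniform_label: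
  fixes J :: "'w \<Rightarrow> nat"
  assumes J: "J \<in> M \<rightarrow>\<^sub>M count_space {1..m}"
    and J_uniform: "distr M (count_space {1..m}) J = uniform_count_measure {1..m}"
    and j: "j \<in> {1..m}"
  shows "emeasure M {\<omega> \<in> space M. J \<omega> = j} = 1 / of_nat m"
proof -
  have "emeasure M {\<omega> \<in> space M. J \<omega> = j} = emeasure (distr M (count_space {1..m}) J) {j}"
    using J j by (subst emeasure_distr) (auto intro!: arg_cong[where f = "emeasure M"])
  also have "\<dots> = ennreal (1 / real m)"
    unfolding J_uniform using j by (subst emeasure_uniform_count_measure) auto
  also have "\<dots> = 1 / of_nat m"
    using j divide_ennreal[of 1 "real m"] by (simp add: ennreal_of_nat_eq_real_of_nat)
  finally show ?thesis .
qed

text \<open>Splitting the error event by the value of \<open>J\<close> gives pieces weighted by the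
  mass of each label. All these masses are 1/m, so the overall error is the plain average of the
  conditional errors, which can be bounded one hypothesis at a time.\<close>

lemma emeasure_ne_uniform:
  fixes J :: "'w \<Rightarrow> nat"
  assumes M: "prob_space M" and m: "m \<ge> 1"
    and J: "J \<in> M \<rightarrow>\<^sub>M count_space {1..m}"
    and J_uniform: "distr M (count_space {1..m}) J = uniform_count_measure {1..m}"
    and T: "T \<in> M \<rightarrow>\<^sub>M count_space {1..m}"
  shows "emeasure M {\<omega> \<in> space M. T \<omega> \<noteq> J \<omega>} =
    (\<Sum>j\<in>{1..m}. emeasure (uniform_measure M {\<omega> \<in> space M. J \<omega> = j}) {\<omega> \<in> space M. T \<omega> \<noteq> j})
      / of_nat m"
proof -
  interpret prob_space M by fact
  have sJ: "{\<omega> \<in> space M. J \<omega> = j} \<in> sets M" and sT: "{\<omega> \<in> space M. T \<omega> \<noteq> j} \<in> sets M" for j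
    using J T by measurable
  have eJ: "emeasure M {\<omega> \<in> space M. J \<omega> = j} = 1 / of_nat m" if "j \<in> {1..m}" for j
    using emeasure_uniform_label[OF J J_uniform that] .
  have "{\<omega> \<in> space M. T \<omega> \<noteq> J \<omega>}
      = (\<Union>j\<in>{1..m}. {\<omega> \<in> space M. J \<omega> = j} \<inter> {\<omega> \<in> space M. T \<omega> \<noteq> j})"
    using measurable_space[OF J] by auto
  then have "emeasure M {\<omega> \<in> space M. T \<omega> \<noteq> J \<omega>}
      = (\<Sum>j\<in>{1..m}. emeasure M ({\<omega> \<in> space M. J \<omega> = j} \<inter> {\<omega> \<in> space M. T \<omega> \<noteq> j}))"
    using sJ sT by (subst sum_emeasure) (auto simp: disjoint_family_on_def)
  also have "\<dots> = (\<Sum>j\<in>{1..m}. emeasure (uniform_measure M {\<omega> \<in> space M. J \<omega> = j})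
      {\<omega> \<in> space M. T \<omega> \<noteq> j} / of_nat m)"
  proof (intro sum.cong refl)
    fix j assume j: "j \<in> {1..m}"
    \<comment> \<open>Conditioning divides by 1/m and averaging divides by m. The two cancel in
      \<open>ennreal\<close> because \<open>of_nat m\<close> is neither 0 nor infinite.\<close>
    have "inverse (inverse (of_nat m)) = (of_nat m :: ennreal)"
      using m by (simp add: ennreal_of_nat_eq_real_of_nat inverse_ennreal)
    moreover have "a * of_nat m / of_nat m = a" for a :: ennreal
      using m by (intro ennreal_mult_divide_eq) auto
    ultimately have "a / (1 / of_nat m) / of_nat m = a" for a :: ennreal
      by (simp only: divide_ennreal_def mult_1)
    then show "emeasure M ({\<omega> \<in> space M. J \<omega> = j} \<inter> {\<omega> \<in> space M. T \<omega> \<noteq> j})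
        = emeasure (uniform_measure M {\<omega> \<in> space M. J \<omega> = j}) {\<omega> \<in> space M. T \<omega> \<noteq> j} / of_nat m"
      by (simp only: emeasure_uniform_measure[OF sJ sT] eJ[OF j])
  qed
  finally show ?thesis
    by (simp add: divide_ennreal_def sum_distrib_right)
qed

theorem theorem0p11:
  fixes \<Theta> :: "'a measure"
    and p :: "'a \<Rightarrow> (real ^ 'k) measure"
    and \<rho> :: "'a \<Rightarrow> 'a \<Rightarrow> real"
    and \<Phi> :: "real \<Rightarrow> real"
    and \<l> :: "'a \<Rightarrow> 'a \<Rightarrow> real"
    and \<delta> :: real
    and n m :: nat
    and \<theta> :: "nat \<Rightarrow> 'a"
    and M :: "'w measure"
    and J :: "'w \<Rightarrow> nat"
    and X :: "nat \<Rightarrow> 'w \<Rightarrow> real ^ 'k"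
  assumes model: "\<And>t. t \<in> space \<Theta> \<Longrightarrow> prob_space (p t) \<and> sets (p t) = sets borel"
    and rho: "pseudometric_on (space \<Theta>) \<rho>"
    and Phi_nonneg: "\<And>u. 0 \<le> u \<Longrightarrow> 0 \<le> \<Phi> u"
    and Phi_mono: "mono_on {0..} \<Phi>"
    and Phi_zero: "\<Phi> 0 = 0"
    and loss: "\<l> = (\<lambda>t t'. \<Phi> (\<rho> t t'))"
    and loss_measurable: "\<And>t. t \<in> space \<Theta> \<Longrightarrow> \<l> t \<in> borel_measurable \<Theta>"
    and delta: "\<delta> > 0"
    and m: "m \<ge> 1"
    and theta: "\<And>j. j \<in> {1..m} \<Longrightarrow> \<theta> j \<in> space \<Theta>"
    and separated:
      "\<And>j j'. j \<in> {1..m} \<Longrightarrow> j' \<in> {1..m} \<Longrightarrow> j \<noteq> j' \<Longrightarrow> \<rho> (\<theta> j) (\<theta> j') \<ge> 2 * \<delta>"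
    and M: "prob_space M"
    and J_measurable: "J \<in> M \<rightarrow>\<^sub>M count_space {1..m}"
    and J_uniform: "distr M (count_space {1..m}) J = uniform_count_measure {1..m}"
    and X_iid_given_J:
      "\<And>j. j \<in> {1..m} \<Longrightarrow>
         iid_from (uniform_measure M {\<omega> \<in> space M. J \<omega> = j}) n (p (\<theta> j)) X"
  shows "minimax_risk \<Theta> p \<l> n \<ge>
    ennreal (\<Phi> \<delta>) *
      (INF \<psi>\<in>sample_space n \<rightarrow>\<^sub>M count_space {1..m}.
         ennreal (\<P>(\<omega> in M. \<psi> (\<lambda>i\<in>{1..n}. X i \<omega>) \<noteq> J \<omega>)))"
proof -
  interpret prob_space M by fact
  define U where "U j = uniform_measure M {\<omega> \<in> space M. J \<omega> = j}" for j
  define Y where "Y \<omega> = (\<lambda>i\<in>{1..n}. X i \<omega>)" for \<omega>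
  \<comment> \<open>Conditioning is legitimate since the event \<open>J = j\<close> has mass 1/m,
    which is nonzero and finite.\<close>
  have U: "prob_space (U j)" if "j \<in> {1..m}" for j
    unfolding U_def using emeasure_uniform_label[OF J_measurable J_uniform that]
    by (intro prob_space_uniform_measure) (use m in \<open>auto simp: ennreal_divide_eq_top_iff\<close>)
  have sets_U: "sets (U j) = sets M" for j
    by (simp add: U_def)
  have Y_law: "distr (U j) (sample_space n) Y = Pi\<^sub>M {1..n} (\<lambda>_. p (\<theta> j))"
    and Y_U: "Y \<in> U j \<rightarrow>\<^sub>M sample_space n" if "j \<in> {1..m}" for j
    using distr_iid_from[OF U X_iid_given_J[folded U_def]] that by (simp_all add: Y_def[abs_def])
  \<comment> \<open>Conditioning leaves the sigma-algebra unchanged, so any one label yields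
    measurability over \<open>M\<close>; label 1 exists because m is at least 1.\<close>
  have Y: "Y \<in> M \<rightarrow>\<^sub>M sample_space n"
    using Y_U[of 1] m by (simp add: measurable_cong_sets[OF sets_U refl])
  show ?thesis
    unfolding minimax_risk_def
  proof (rule INF_greatest)
    fix est :: "(nat \<Rightarrow> real ^ 'k) \<Rightarrow> 'a"
    assume est: "est \<in> sample_space n \<rightarrow>\<^sub>M \<Theta>"
    define close where "close x j \<longleftrightarrow> j \<in> {1..m} \<and> \<l> (\<theta> j) (est x) < \<Phi> \<delta>" for x j
    \<comment> \<open>At most one index will turn out to be close, so \<open>LEAST\<close> merely
      selects it in a visibly measurable way. The default 1 keeps the test inside the label set when
      no hypothesis is close.\<close>
    define \<psi> where "\<psi> x = (if \<exists>j. close x j then LEAST j. close x j else 1)" for x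
    have est_space: "est x \<in> space \<Theta>" if "x \<in> space (sample_space n)" for x
      using measurable_space[OF est that] .
    have close: "Measurable.pred (sample_space n) (\<lambda>x. close x j)" for j
    proof (cases "j \<in> {1..m}")
      case True
      have "(\<lambda>x. \<l> (\<theta> j) (est x)) \<in> borel_measurable (sample_space n)"
        using measurable_compose[OF est loss_measurable[OF theta[OF True]]] .
      then have "Measurable.pred (sample_space n) (\<lambda>x. \<l> (\<theta> j) (est x) < \<Phi> \<delta>)"
        by (rule borel_measurable_pred_less[OF _ borel_measurable_const])
      then show ?thesis
        using True by (simp add: close_def)
    next
      case False
      then have "(\<lambda>x. close x j) = (\<lambda>_. False)"
        unfolding close_def by blast
      then show ?thesis
        by simp
    qed
    have close_\<psi>: "close x (\<psi> x)" if "close x j" for x j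
      using that by (auto simp: \<psi>_def intro: LeastI)
    \<comment> \<open>Measurability is first obtained into all naturals, where the rule for
      \<open>LEAST\<close> applies, and is then restricted to the labels using the range of the
      test.\<close>
    have "\<psi> \<in> sample_space n \<rightarrow>\<^sub>M count_space UNIV"
      unfolding \<psi>_def
      by (intro measurable_If measurable_Least predE pred_intros_countable(2) close measurable_const)
        simp
    moreover have "\<psi> x \<in> {1..m}" for x
    proof (cases "\<exists>j. close x j")
      case True
      then show ?thesis
        using close_\<psi> close_def by blast
    qed (use m in \<open>simp add: \<psi>_def\<close>)
    ultimately have "\<psi> \<in> sample_space n \<rightarrow>\<^sub>M restrict_space (count_space UNIV) {1..m}"
      by (intro measurable_restrict_space2) auto
    then have \<psi>: "\<psi> \<in> sample_space n \<rightarrow>\<^sub>M count_space {1..m}"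
      by (simp add: restrict_count_space)
    \<comment> \<open>Contrapositive of monotonicity: a distance of at least \<delta> would force a
      loss of at least \<Phi> \<delta>.\<close>
    have near: "\<rho> (\<theta> j) (est x) < \<delta>" if "close x j" "x \<in> space (sample_space n)" for x j
    proof (rule ccontr)
      assume "\<not> \<rho> (\<theta> j) (est x) < \<delta>"
      then have "\<Phi> \<delta> \<le> \<Phi> (\<rho> (\<theta> j) (est x))"
        using delta by (intro mono_onD[OF Phi_mono]) auto
      then show False
        using that(1) by (simp add: close_def loss)
    qed
    \<comment> \<open>Two close hypotheses would be joined through the estimate by a path of length
      strictly below 2 \<delta>, against the separation.\<close>
    have unique: "j = j'" if "close x j" "close x j'" "x \<in> space (sample_space n)" for x j j'
    proof (rule ccontr)
      assume "j \<noteq> j'"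
      have j: "j \<in> {1..m}" "j' \<in> {1..m}"
        using that by (auto simp: close_def)
      have "\<rho> (\<theta> j) (\<theta> j') \<le> \<rho> (\<theta> j) (est x) + \<rho> (est x) (\<theta> j')"
        and "\<rho> (est x) (\<theta> j') = \<rho> (\<theta> j') (est x)"
        using rho theta[OF j(1)] theta[OF j(2)] est_space[OF that(3)]
        unfolding pseudometric_on_def by blast+
      then show False
        using near[OF that(1,3)] near[OF that(2,3)] separated[OF j \<open>j \<noteq> j'\<close>] by linarith
    qed
    \<comment> \<open>If the loss at \<open>j\<close> were below the threshold, then
      \<open>j\<close> would be close. The test would then output a close index too, and uniqueness
      would make that index \<open>j\<close>.\<close>
    have error: "\<Phi> \<delta> \<le> \<l> (\<theta> j) (est x)"
      if "\<psi> x \<noteq> j" "j \<in> {1..m}" "x \<in> space (sample_space n)" for x j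
    proof (rule ccontr)
      assume "\<not> \<Phi> \<delta> \<le> \<l> (\<theta> j) (est x)"
      then have "close x j"
        using that by (simp add: close_def)
      then show False
        using unique[OF _ close_\<psi> that(3)] that(1) by blast
    qed
    \<comment> \<open>A Markov-type bound: on the error event the loss is at least the constant
      \<Phi> \<delta>, so \<Phi> \<delta> times the indicator lies pointwise below the loss. The
      event is first carried to the sample space along \<open>Y\<close>, whose conditional law is
      the product measure.\<close>
    have risk_ge: "ennreal (\<Phi> \<delta>) * emeasure (U j) {\<omega> \<in> space M. \<psi> (Y \<omega>) \<noteq> j}
        \<le> risk p \<l> n (\<theta> j) est" if j: "j \<in> {1..m}" for j
    proof -
      let ?P = "Pi\<^sub>M {1..n} (\<lambda>_. p (\<theta> j))"
      let ?E = "{x \<in> space (sample_space n). \<psi> x \<noteq> j}"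
      have sets_P: "sets ?P = sets (sample_space n)"
        using model[OF theta[OF j]] by (intro sets_PiM_cong) auto
      have E: "?E \<in> sets (sample_space n)"
        using \<psi> by measurable
      have "Y -` ?E \<inter> space (U j) = {\<omega> \<in> space M. \<psi> (Y \<omega>) \<noteq> j}"
        using measurable_space[OF Y] by (auto simp: U_def)
      then have "emeasure (U j) {\<omega> \<in> space M. \<psi> (Y \<omega>) \<noteq> j} = emeasure ?P ?E"
        by (simp only: Y_law[OF j, symmetric] emeasure_distr[OF Y_U[OF j] E])
      then have "ennreal (\<Phi> \<delta>) * emeasure (U j) {\<omega> \<in> space M. \<psi> (Y \<omega>) \<noteq> j}
          = (\<integral>\<^sup>+ x. ennreal (\<Phi> \<delta>) * indicator ?E x \<partial>?P)"
        using E by (simp only: sets_P nn_integral_cmult_indicator)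
      also have "\<dots> \<le> (\<integral>\<^sup>+ x. ennreal (\<l> (\<theta> j) (est x)) \<partial>?P)"
        using error[OF _ j] by (intro nn_integral_mono) (auto simp: indicator_def intro!: ennreal_leI)
      finally show ?thesis
        by (simp add: risk_def)
    qed
    have "ennreal (\<Phi> \<delta>) * emeasure M {\<omega> \<in> space M. \<psi> (Y \<omega>) \<noteq> J \<omega>}
        = (\<Sum>j\<in>{1..m}. ennreal (\<Phi> \<delta>) * emeasure (U j) {\<omega> \<in> space M. \<psi> (Y \<omega>) \<noteq> j}) / of_nat m"
      using emeasure_ne_uniform[OF M m J_measurable J_uniform measurable_compose[OF Y \<psi>]]
      by (simp add: U_def ennreal_times_divide sum_distrib_left)
    \<comment> \<open>Every \<open>\<theta> j\<close> is a parameter, so each of the m terms is at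
      most the worst-case risk, and the average of m copies of that bound is the bound
      itself.\<close>
    also have "\<dots> \<le> (\<Sum>j\<in>{1..m}. SUP t\<in>space \<Theta>. risk p \<l> n t est) / of_nat m"
    proof (intro divide_right_mono_ennreal sum_mono)
      fix j assume j: "j \<in> {1..m}"
      show "ennreal (\<Phi> \<delta>) * emeasure (U j) {\<omega> \<in> space M. \<psi> (Y \<omega>) \<noteq> j}
          \<le> (SUP t\<in>space \<Theta>. risk p \<l> n t est)"
        using theta[OF j] risk_ge[OF j] by (rule SUP_upper2)
    qed
    also have "\<dots> = (SUP t\<in>space \<Theta>. risk p \<l> n t est)"
      using m ennreal_mult_divide_eq[of "of_nat m"] by (simp add: mult.commute[of "of_nat m"])
    finally have "ennreal (\<Phi> \<delta>) * ennreal (\<P>(\<omega> in M. \<psi> (Y \<omega>) \<noteq> J \<omega>))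
        \<le> (SUP t\<in>space \<Theta>. risk p \<l> n t est)"
      by (simp add: emeasure_eq_measure)
    \<comment> \<open>The test built from the estimator is one competitor in the infimum over all
      tests.\<close>
    moreover have "(INF \<psi>\<in>sample_space n \<rightarrow>\<^sub>M count_space {1..m}.
        ennreal (\<P>(\<omega> in M. \<psi> (\<lambda>i\<in>{1..n}. X i \<omega>) \<noteq> J \<omega>)))
        \<le> ennreal (\<P>(\<omega> in M. \<psi> (Y \<omega>) \<noteq> J \<omega>))"
      unfolding Y_def using \<psi> by (rule INF_lower)
    ultimately show "ennreal (\<Phi> \<delta>) * (INF \<psi>\<in>sample_space n \<rightarrow>\<^sub>M count_space {1..m}.
        ennreal (\<P>(\<omega> in M. \<psi> (\<lambda>i\<in>{1..n}. X i \<omega>) \<noteq> J \<omega>)))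
        \<le> (SUP t\<in>space \<Theta>. risk p \<l> n t est)"
      by (meson mult_left_mono order_trans zero_le)
  qed
qed

end
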